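(* There is a bijective correspondence between ambitoric Einstein–Maxwell metrics $\tilde g=\frac1{f^2}g$ of positive regular type, associated to a positive Killing potential $f(x,y)$, on one side, and ambitoric extremal Kähler metrics $\bar g$ of positive regular type, of positive scalar curvature $s_{\bar g}(x,y)$, on the other, such that $f(x,y)=1/s_{\bar g}(x,y)$. Furthermore, if $q(z),A(z),B(z)$ are the polynomials defining $g$, and $p(z)$ is the quadratic polynomial defining the Killing potential $f=p(x,y)/q(x,y)$, then $\bar g$ has corresponding polynomials $\bar q(z)=p(z)$, $\bar A(z)=A(z)$, $\bar B(z)=B(z)$, whereas $q(x,y)=s_{\bar g}(x,y)\,\bar q(x,y)$. In particular, $g=\bar g$ if and only if $f=\mathrm{const}$, i.e. $\tilde g$ is a constant scalar curvature Kähler regular ambitoric metric.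
   Context: $S^2$ is the space of real polynomials $w(z)=w_2z^2+2w_1z+w_0$ of degree $\le2$; $w(x,y):=w_2xy+w_1(x+y)+w_0$; $\langle p,w\rangle:=2p_1w_1-(p_2w_0+p_0w_2)$; $\{q,w\}:=q'w-w'q\in S^2$. For $G\in S^2$ and $R$ a polynomial of degree $\le4$, $(G,R)^{(2)}:=R''G-3R'G'+6RG''\in S^2$. All metrics are local, defined on open sets where $x>y$ and where the functions required to be positive below are positive. Given $q\in S^2$ with $q(x,y)>0$, and positive functions $A(x)$, $B(y)$, the ambitoric Kähler metric of positive regular type defined by $(q,A,B)$ is $$g=g_+=\frac{x-y}{q(x,y)}\Big(\frac{dx^2}{A(x)}+\frac{dy^2}{B(y)}+A(x)\Big(\frac{y^2d\tau_0+2yd\tau_1+d\tau_2}{(x-y)q(x,y)}\Big)^2+B(y)\Big(\frac{x^2d\tau_0+2xd\tau_1+d\tau_2}{(x-y)q(x,y)}\Big)^2\Big),$$ $$\omega_+=\frac{dx\wedge(y^2d\tau_0+2yd\tau_1+d\tau_2)+dy\wedge(x^2d\tau_0+2xd\tau_1+d\tau_2)}{q(x,y)^2},$$ where $\tau_0,\tau_1,\tau_2$ are functions subject to $2q_1\tau_1=q_2\tau_2+q_0\tau_0$ (so that $d\tau_0,d\tau_1,d\tau_2$ span two dimensions). The Killing potentials of the torus action are the functions $w(x,y)/q(x,y)$, $w\in S^2$. *Ambitoric extremal Kähler metric of positive regular type*: the metric $\bar g=g_+$ defined by $(\bar q,\bar A,\bar B)$, where $\bar A=\bar q\pi+P$,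 $\bar B=\bar q\pi-P$ with $\pi\in S^2$, $\langle\pi,\bar q\rangle=0$ and $P$ a polynomial of degree $\le4$. Its scalar curvature is $s_{\bar g}=-\{\bar q,(\bar q,P)^{(2)}\}(x,y)/\bar q(x,y)$. *Ambitoric Einstein–Maxwell metric of positive regular type*: $\tilde g=\frac1{f^2}g$ with $g=g_+$ defined by $(q,A,B)$, $f=p(x,y)/q(x,y)$ with $p\in S^2$, $\langle p,q\rangle=0$, $p(x,y)>0$, and $A=p\rho+R$, $B=p\rho-R$, $\langle(p,R)^{(2)},q\rangle=0$, with $\rho\in S^2$, $\langle\rho,p\rangle=0$ and $R$ a polynomial of degree $\le4$. Then $\tilde g$ has constant scalar curvature $s_{\tilde g}=-\{p,(p,R)^{(2)}\}(x,y)/q(x,y)$.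
   Formalization: The Einstein–Maxwell side is normalised to scalar curvature 1, as f=1/s forces (positive ones rescale uniquely to this); "g=ḡ iff f=const" becomes "g, ḡ homothetic iff f=const, and g=ḡ iff f=1". *)

theory Defs
  imports "HOL-Analysis.Analysis" "HOL-Computational_Algebra.Polynomial"
begin

definition S2 :: "real poly set" where
  "S2 = {w. degree w \<le> 2}"

text \<open>A quadratic is normalised as \<open>w = w2 z^2 + 2 w1 z + w0\<close>, so that
  \<open>w1 = coeff w 1 / 2\<close>.\<close>

definition polar :: "real poly \<Rightarrow> real \<Rightarrow> real \<Rightarrow> real" where
  "polar w x y = coeff w 2 * x * y + coeff w 1 / 2 * (x + y) + coeff w 0"

definition pairing :: "real poly \<Rightarrow> real poly \<Rightarrow> real" where
  "pairing p w = 2 * (coeff p 1 / 2) * (coeff w 1 / 2)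
     - (coeff p 2 * coeff w 0 + coeff p 0 * coeff w 2)"

definition bracket :: "real poly \<Rightarrow> real poly \<Rightarrow> real poly" where
  "bracket q w = pderiv q * w - pderiv w * q"

definition transvectant2 :: "real poly \<Rightarrow> real poly \<Rightarrow> real poly" where
  "transvectant2 G R =
     pderiv (pderiv R) * G - 3 * (pderiv R * pderiv G) + 6 * (R * pderiv (pderiv G))"

text \<open>A torus-invariant metric over a region \<open>U\<close> of the \<open>(x, y)\<close>-plane is a pair \<open>(T, G)\<close>.
  The plane \<open>T\<close> is the space of values of \<open>(d\<tau>0, d\<tau>1, d\<tau>2)\<close>, and \<open>G (x, y)\<close> is the line element
  at any point of the torus orbit over \<open>(x, y)\<close>, as a quadratic form in
  \<open>(dx, dy, (d\<tau>0, d\<tau>1, d\<tau>2))\<close>. Outside \<open>U\<close> and \<open>T\<close> it is set to \<open>0\<close>, so that equality of pairs is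
  equality of tensor fields over \<open>U\<close>.\<close>

type_synonym tvec = "real \<times> real \<times> real"
type_synonym line_element = "real \<times> real \<Rightarrow> real \<times> real \<times> tvec \<Rightarrow> real"
type_synonym tmetric = "tvec set \<times> line_element"

definition torus_plane :: "real poly \<Rightarrow> tvec set" where
  "torus_plane q = {(t0, t1, t2). 2 * (coeff q 1 / 2) * t1 = coeff q 2 * t2 + coeff q 0 * t0}"

definition ambitoric_metric ::
  "(real \<times> real) set \<Rightarrow> real poly \<Rightarrow> (real \<Rightarrow> real) \<Rightarrow> (real \<Rightarrow> real) \<Rightarrow> tmetric" where
  "ambitoric_metric U q A B = (torus_plane q, \<lambda>(x, y) (dx, dy, (t0, t1, t2)).
     if (x, y) \<in> U \<and> (t0, t1, t2) \<in> torus_plane q then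
       (x - y) / polar q x y *
         (dx\<^sup>2 / A x + dy\<^sup>2 / B y
          + A x * ((y\<^sup>2 * t0 + 2 * y * t1 + t2) / ((x - y) * polar q x y))\<^sup>2
          + B y * ((x\<^sup>2 * t0 + 2 * x * t1 + t2) / ((x - y) * polar q x y))\<^sup>2)
     else 0)"

definition ambitoric_data ::
  "(real \<times> real) set \<Rightarrow> real poly \<Rightarrow> (real \<Rightarrow> real) \<Rightarrow> (real \<Rightarrow> real) \<Rightarrow> bool" where
  "ambitoric_data U q A B \<longleftrightarrow>
     q \<in> S2 \<and> (\<forall>(x, y) \<in> U. polar q x y > 0 \<and> A x > 0 \<and> B y > 0)"

definition extremal_data ::
  "(real \<times> real) set \<Rightarrow> real poly \<Rightarrow> real poly \<Rightarrow> real poly \<Rightarrow> bool" where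
  "extremal_data U q \<pi> P \<longleftrightarrow>
     \<pi> \<in> S2 \<and> pairing \<pi> q = 0 \<and> degree P \<le> 4
     \<and> ambitoric_data U q (poly (q * \<pi> + P)) (poly (q * \<pi> - P))"

definition extremal_metric ::
  "(real \<times> real) set \<Rightarrow> real poly \<Rightarrow> real poly \<Rightarrow> real poly \<Rightarrow> tmetric" where
  "extremal_metric U q \<pi> P = ambitoric_metric U q (poly (q * \<pi> + P)) (poly (q * \<pi> - P))"

definition extremal_scal :: "real poly \<Rightarrow> real poly \<Rightarrow> real \<Rightarrow> real \<Rightarrow> real" where
  "extremal_scal q P x y = - polar (bracket q (transvectant2 q P)) x y / polar q x y"

definition positive_extremal_metrics :: "(real \<times> real) set \<Rightarrow> tmetric set" where
  "positive_extremal_metrics U = {extremal_metric U q \<pi> P | q \<pi> P.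
     extremal_data U q \<pi> P \<and> (\<forall>(x, y) \<in> U. extremal_scal q P x y > 0)}"

definition cscK_metrics :: "(real \<times> real) set \<Rightarrow> tmetric set" where
  "cscK_metrics U = {extremal_metric U q \<pi> P | q \<pi> P.
     extremal_data U q \<pi> P \<and> (\<exists>c. \<forall>(x, y) \<in> U. extremal_scal q P x y = c)}"

definition killing_potential ::
  "(real \<times> real) set \<Rightarrow> real poly \<Rightarrow> real poly \<Rightarrow> real \<times> real \<Rightarrow> real" where
  "killing_potential U q p = (\<lambda>(x, y). if (x, y) \<in> U then polar p x y / polar q x y else 0)"

definition em_data ::
  "(real \<times> real) set \<Rightarrow> real poly \<Rightarrow> real poly \<Rightarrow> real poly \<Rightarrow> real poly \<Rightarrow> bool" where
  "em_data U q p \<rho> R \<longleftrightarrow>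
     p \<in> S2 \<and> pairing p q = 0 \<and> (\<forall>(x, y) \<in> U. polar p x y > 0)
     \<and> \<rho> \<in> S2 \<and> pairing \<rho> p = 0 \<and> degree R \<le> 4 \<and> pairing (transvectant2 p R) q = 0
     \<and> ambitoric_data U q (poly (p * \<rho> + R)) (poly (p * \<rho> - R))"

definition em_kahler_metric ::
  "(real \<times> real) set \<Rightarrow> real poly \<Rightarrow> real poly \<Rightarrow> real poly \<Rightarrow> real poly \<Rightarrow> tmetric" where
  "em_kahler_metric U q p \<rho> R = ambitoric_metric U q (poly (p * \<rho> + R)) (poly (p * \<rho> - R))"

definition conformal :: "(real \<times> real \<Rightarrow> real) \<Rightarrow> tmetric \<Rightarrow> tmetric" where
  "conformal f g = (fst g, \<lambda>z v. 1 / (f z)\<^sup>2 * snd g z v)"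

text \<open>An Einstein--Maxwell metric is recorded together with its Killing potential, because
  \<open>(c^2 g, c f)\<close> and \<open>(g, f)\<close> give the same metric \<open>1/f^2 g\<close>.\<close>

definition em_pair ::
  "(real \<times> real) set \<Rightarrow> real poly \<Rightarrow> real poly \<Rightarrow> real poly \<Rightarrow> real poly
     \<Rightarrow> tmetric \<times> (real \<times> real \<Rightarrow> real)" where
  "em_pair U q p \<rho> R =
     (conformal (killing_potential U q p) (em_kahler_metric U q p \<rho> R), killing_potential U q p)"

definition em_scal :: "real poly \<Rightarrow> real poly \<Rightarrow> real poly \<Rightarrow> real \<Rightarrow> real \<Rightarrow> real" where
  "em_scal q p R x y = - polar (bracket p (transvectant2 p R)) x y / polar q x y"

text \<open>The relation \<open>f = 1/s\<close> between the two sides fixes the homothety factor of the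
  Einstein--Maxwell metric: it forces its (constant) scalar curvature to be \<open>1\<close>.\<close>

definition normalised_em_pairs ::
  "(real \<times> real) set \<Rightarrow> (tmetric \<times> (real \<times> real \<Rightarrow> real)) set" where
  "normalised_em_pairs U = {em_pair U q p \<rho> R | q p \<rho> R.
     em_data U q p \<rho> R \<and> (\<forall>(x, y) \<in> U. em_scal q p R x y = 1)}"

text \<open>Equality up to a constant factor and a linear change of the angular coordinates.\<close>

definition homothetic :: "(real \<times> real) set \<Rightarrow> tmetric \<Rightarrow> tmetric \<Rightarrow> bool" where
  "homothetic U g h \<longleftrightarrow> (\<exists>k>0. \<exists>L. linear L \<and> bij_betw L (fst g) (fst h)
     \<and> (\<forall>z \<in> U. \<forall>dx dy. \<forall>t \<in> fst g. snd g z (dx, dy, t) = k * snd h z (dx, dy, L t)))"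

end

theory Submission
  imports Defs
begin

text \<open>
  Write \<open>W\<close> for the transvectant of \<open>p\<close> and \<open>R\<close>, a quadratic. An Einstein--Maxwell metric has data
  \<open>(q, p, \<rho>, R)\<close>. Forgetting \<open>q\<close> leaves \<open>(p, \<rho>, R)\<close>, which satisfies every condition
  for extremal data, with the same \<open>A\<close> and \<open>B\<close>. What remains is to see that \<open>q\<close> can be
  recovered. The pairing on quadratics is nondegenerate, so in three dimensions the bracket plays the
  role of the cross product: \<open>bracket p W\<close> is orthogonal to \<open>p\<close> and \<open>W\<close>, and it spans the quadratics
  with this property unless it vanishes. The orthogonality conditions on \<open>q\<close> therefore say that
  \<open>bracket p W = - s q\<close> for a constant \<open>s\<close>, the scalar curvature of the Einstein--Maxwell metric
  (\<open>bracket_transvectant2_em\<close>). Rescaling the potential makes a positive \<open>s\<close> equal to \<open>1\<close>, and then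
  \<open>q = - bracket p W\<close> is determined by \<open>(p, R)\<close>, with
  \<open>q(x, y)/p(x, y)\<close> the scalar curvature of the extremal metric. Conversely, for extremal data of
  positive scalar curvature this formula defines a positive \<open>q\<close> that meets both orthogonality
  conditions (\<open>extremal_imp_em_data\<close>).

  To turn this bijection of data into one of metrics, the metric has to determine its data
  (\<open>ambitoric_metric_inject\<close>). The plane of angular directions is the orthogonal complement of \<open>q\<close>
  and gives \<open>q\<close> up to scale; comparing the \<open>dx\<^sup>2\<close> coefficient with the angular part fixes the scale;
  the \<open>dx\<^sup>2\<close> and \<open>dy\<^sup>2\<close> coefficients then give \<open>A\<close> and \<open>B\<close>.

  The potential \<open>f = p(x, y)/q(x, y)\<close> is constant exactly when \<open>p\<close> and \<open>q\<close> are proportional. The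
  metrics defined by \<open>q\<close> and \<open>p\<close> with the same \<open>A\<close>, \<open>B\<close> are then homothetic, and \<open>1/f\<^sup>2 g\<close> is
  an extremal metric of scalar curvature \<open>1\<close>; the converses are read off from the coefficients of
  \<open>dx\<^sup>2\<close> and \<open>dy\<^sup>2\<close>.
\<close>

section \<open>Quadratic polynomials\<close>

lemma S2_pCons: "w \<in> S2 \<Longrightarrow> w = [:coeff w 0, coeff w 1, coeff w 2:]"
  by (rule poly_eqI)
    (auto simp: S2_def coeff_pCons numeral_2_eq_2 coeff_eq_0 split: nat.splits)

lemma pCons_S2: "[:a, b, c:] \<in> S2"
  by (auto simp: S2_def)

lemma S2_eqI:
  assumes "v \<in> S2" "w \<in> S2" "coeff v 0 = coeff w 0" "coeff v 1 = coeff w 1" "coeff v 2 = coeff w 2"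
  shows "v = w"
  using S2_pCons[OF assms(1)] S2_pCons[OF assms(2)] assms(3-5) by simp

lemma S2_smult: "w \<in> S2 \<Longrightarrow> smult c w \<in> S2"
  unfolding S2_def using degree_smult_le[of c w] by simp

lemma polar_smult: "polar (smult c w) x y = c * polar w x y"
  by (simp add: polar_def algebra_simps)

lemma polar_uminus: "polar (- w) x y = - polar w x y"
  by (simp add: polar_def algebra_simps)

lemma polar_diff: "polar (v - w) x y = polar v x y - polar w x y"
  by (simp add: polar_def algebra_simps diff_divide_distrib)

lemma pairing_smult_left: "pairing (smult c p) w = c * pairing p w"
  and pairing_smult_right: "pairing p (smult c w) = c * pairing p w"
  by (simp_all add: pairing_def algebra_simps)

lemma pairing_uminus_right: "pairing p (- w) = - pairing p w"
  by (simp add: pairing_def algebra_simps)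

lemma open_contains_box:
  fixes U :: "(real \<times> real) set"
  assumes "open U" "(a, b) \<in> U"
  obtains e where "e > 0" "\<And>x y. \<bar>x - a\<bar> < e \<Longrightarrow> \<bar>y - b\<bar> < e \<Longrightarrow> (x, y) \<in> U"
proof -
  obtain V W where VW: "open V" "open W" "a \<in> V" "b \<in> W" "V \<times> W \<subseteq> U"
    using open_prod_elim[OF assms] by (metis SigmaE2)
  obtain d where d: "d > 0" "\<And>x. dist x a < d \<Longrightarrow> x \<in> V"
    using VW(1,3) unfolding open_dist by blast
  obtain e where e: "e > 0" "\<And>x. dist x b < e \<Longrightarrow> x \<in> W"
    using VW(2,4) unfolding open_dist by blast
  show thesis
    by (rule that[of "min d e"]) (use d e VW(5) in \<open>auto simp: dist_real_def\<close>)
qed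

text \<open>A mixed second difference over a small square isolates the coefficient of \<open>x y\<close>, a first
  difference then the coefficient of \<open>x + y\<close>.\<close>

lemma polar_eq_0_on_open:
  assumes "open U" "U \<noteq> {}" "w \<in> S2" "\<And>x y. (x, y) \<in> U \<Longrightarrow> polar w x y = 0"
  shows "w = 0"
proof -
  obtain a b where "(a, b) \<in> U" using assms(2) by auto
  then obtain e where e: "e > 0" "\<And>x y. \<bar>x - a\<bar> < e \<Longrightarrow> \<bar>y - b\<bar> < e \<Longrightarrow> (x, y) \<in> U"
    using open_contains_box[OF assms(1)] by metis
  define d where "d = e / 2"
  have d: "d > 0" "d < e" using e(1) by (auto simp: d_def)
  have z: "polar w a b = 0" "polar w (a + d) b = 0" "polar w a (b + d) = 0"
    "polar w (a + d) (b + d) = 0"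
    using d e by (auto intro!: assms(4))
  have "coeff w 2 * d * d
    = polar w (a + d) (b + d) - polar w (a + d) b - polar w a (b + d) + polar w a b"
    by (simp add: polar_def field_simps)
  with z d have c2: "coeff w 2 = 0" by simp
  have "coeff w 1 / 2 * d = polar w (a + d) b - polar w a b"
    by (simp add: polar_def c2 field_simps)
  with z d have c1: "coeff w 1 = 0" by simp
  have c0: "coeff w 0 = 0" using z(1) unfolding polar_def c2 c1 by simp
  show ?thesis by (subst S2_pCons[OF assms(3)]) (simp only: c0 c1 c2 pCons_0_0)
qed

lemma polar_eq_on_open:
  assumes "open U" "U \<noteq> {}" "v \<in> S2" "w \<in> S2" "\<And>x y. (x, y) \<in> U \<Longrightarrow> polar v x y = polar w x y"
  shows "v = w"
proof -
  have "v - w \<in> S2"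
    using assms(3,4) degree_diff_le[of v 2 w] by (simp add: S2_def)
  moreover have "polar (v - w) x y = 0" if "(x, y) \<in> U" for x y
    using assms(5)[OF that] by (simp add: polar_diff)
  ultimately have "v - w = 0"
    using assms(1,2) by (intro polar_eq_0_on_open[of U "v - w"]) auto
  then show ?thesis by simp
qed

lemma poly_eq_on_interval:
  fixes v w :: "real poly"
  assumes "e > 0" "\<And>x. \<bar>x - a\<bar> < e \<Longrightarrow> poly v x = poly w x"
  shows "v = w"
proof (rule ccontr)
  assume "v \<noteq> w"
  then have "finite {x. poly (v - w) x = 0}" by (intro poly_roots_finite) simp
  moreover have "{a<..<a + e} \<subseteq> {x. poly (v - w) x = 0}"
    using assms(2) by auto
  ultimately show False
    using assms(1) infinite_Ioo[of a "a + e"] finite_subset by (metis less_add_same_cancel1)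
qed

text \<open>The hypotheses say that the \<open>2 \<times> 2\<close> minors of the coefficient vectors vanish. Comparing
  polarised values at a point where that of \<open>q\<close> is nonzero gives the factor.\<close>

lemma parallel_eq_smult:
  assumes "q \<in> S2" "r \<in> S2"
    and "coeff q 0 * coeff r 1 = coeff q 1 * coeff r 0"
    and "coeff q 0 * coeff r 2 = coeff q 2 * coeff r 0"
    and "coeff q 1 * coeff r 2 = coeff q 2 * coeff r 1"
    and "polar q x y \<noteq> 0"
  shows "r = smult (polar r x y / polar q x y) q"
proof -
  have *: "coeff r i * polar q x y = coeff q i * polar r x y" if "i \<in> {0, 1, 2}" for i
  proof -
    have "coeff r i * coeff q j = coeff q i * coeff r j" if "j \<in> {0, 1, 2}" for j
      using \<open>i \<in> _\<close> that assms(3-5) by (auto simp: mult.commute)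
    then have "coeff r i * coeff q 0 = coeff q i * coeff r 0"
      "coeff r i * coeff q 1 = coeff q i * coeff r 1"
      "coeff r i * coeff q 2 = coeff q i * coeff r 2" by auto
    then show ?thesis unfolding polar_def by algebra
  qed
  show ?thesis
    by (rule S2_eqI[OF assms(2) S2_smult[OF assms(1)]])
      (use *[of 0] *[of 1] *[of 2] assms(6) in \<open>auto simp: field_simps\<close>)
qed

section \<open>Bracket and transvectant\<close>

lemma bracket_pCons:
  "bracket [:p0, p1, p2:] [:w0, w1, w2:]
    = [:p1 * w0 - p0 * w1, 2 * (p2 * w0 - p0 * w2), p2 * w1 - p1 * w2:]"
  by (simp add: bracket_def pderiv_pCons algebra_simps)

lemma bracket_S2:
  assumes "p \<in> S2" "w \<in> S2"
  shows "bracket p w \<in> S2"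
  by (subst S2_pCons[OF assms(1)], subst S2_pCons[OF assms(2)])
    (simp only: bracket_pCons pCons_S2)

lemma coeff_bracket:
  assumes "p \<in> S2" "w \<in> S2"
  shows "coeff (bracket p w) 0 = coeff p 1 * coeff w 0 - coeff p 0 * coeff w 1"
    and "coeff (bracket p w) 1 = 2 * (coeff p 2 * coeff w 0 - coeff p 0 * coeff w 2)"
    and "coeff (bracket p w) 2 = coeff p 2 * coeff w 1 - coeff p 1 * coeff w 2"
proof -
  have "bracket p w = [:coeff p 1 * coeff w 0 - coeff p 0 * coeff w 1,
      2 * (coeff p 2 * coeff w 0 - coeff p 0 * coeff w 2),
      coeff p 2 * coeff w 1 - coeff p 1 * coeff w 2:]"
    using S2_pCons[OF assms(1)] S2_pCons[OF assms(2)] bracket_pCons by metis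
  then show "coeff (bracket p w) 0 = coeff p 1 * coeff w 0 - coeff p 0 * coeff w 1"
    "coeff (bracket p w) 1 = 2 * (coeff p 2 * coeff w 0 - coeff p 0 * coeff w 2)"
    "coeff (bracket p w) 2 = coeff p 2 * coeff w 1 - coeff p 1 * coeff w 2"
    by (simp_all add: numeral_2_eq_2)
qed

text \<open>The pairing is nondegenerate and the bracket is, up to scale, its cross product. Hence
  \<open>bracket p w\<close> is orthogonal to \<open>p\<close> and \<open>w\<close>, and anything orthogonal to both is parallel to it.\<close>

lemma pairing_bracket:
  assumes "p \<in> S2" "w \<in> S2"
  shows "pairing p (bracket p w) = 0" and "pairing w (bracket p w) = 0"
  unfolding pairing_def coeff_bracket[OF assms] by (simp_all add: algebra_simps diff_divide_distrib)

lemma orthogonal_imp_parallel_bracket: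
  assumes "p \<in> S2" "w \<in> S2" "q \<in> S2" "pairing p q = 0" "pairing w q = 0" "polar q x y \<noteq> 0"
  shows "bracket p w = smult (polar (bracket p w) x y / polar q x y) q"
proof (rule parallel_eq_smult[OF assms(3) bracket_S2[OF assms(1,2)] _ _ _ assms(6)])
  have p: "coeff p 1 * coeff q 1 = 2 * (coeff p 2 * coeff q 0 + coeff p 0 * coeff q 2)"
    and w: "coeff w 1 * coeff q 1 = 2 * (coeff w 2 * coeff q 0 + coeff w 0 * coeff q 2)"
    using assms(4,5) by (simp_all add: pairing_def)
  show "coeff q 0 * coeff (bracket p w) 1 = coeff q 1 * coeff (bracket p w) 0"
    unfolding coeff_bracket[OF assms(1,2)] using p w by algebra
  show "coeff q 0 * coeff (bracket p w) 2 = coeff q 2 * coeff (bracket p w) 0"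
    unfolding coeff_bracket[OF assms(1,2)] using p w by algebra
  show "coeff q 1 * coeff (bracket p w) 2 = coeff q 2 * coeff (bracket p w) 1"
    unfolding coeff_bracket[OF assms(1,2)] using p w by algebra
qed

lemma bracket_smult:
  "bracket (smult c p) w = smult c (bracket p w)" "bracket p (smult c w) = smult c (bracket p w)"
  by (simp_all add: bracket_def pderiv_smult smult_diff_right)

lemma transvectant2_smult:
  "transvectant2 (smult c p) R = smult c (transvectant2 p R)"
  "transvectant2 p (smult c R) = smult c (transvectant2 p R)"
  by (simp_all add: transvectant2_def pderiv_smult smult_diff_right smult_add_right)

lemma transvectant2_S2:
  assumes "G \<in> S2" "degree R \<le> 4"
  shows "transvectant2 G R \<in> S2"
proof -
  have pcons: "transvectant2 [:g0, g1, g2:] [:r0, r1, r2, r3, r4:]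
    = [:2 * r2 * g0 - 3 * r1 * g1 + 12 * r0 * g2,
       6 * r3 * g0 - 4 * r2 * g1 + 6 * r1 * g2,
       12 * r4 * g0 - 3 * r3 * g1 + 2 * r2 * g2:]" for g0 g1 g2 r0 r1 r2 r3 r4
    by (simp add: transvectant2_def pderiv_pCons numeral_poly algebra_simps)
  have "R = [:coeff R 0, coeff R 1, coeff R 2, coeff R 3, coeff R 4:]"
    using assms(2)
    by (intro poly_eqI) (auto simp: coeff_pCons eval_nat_numeral coeff_eq_0 split: nat.splits)
  then show ?thesis
    by (subst S2_pCons[OF assms(1)]) (metis pcons pCons_S2)
qed

section \<open>A metric determines its defining data\<close>

text \<open>The plane is the orthogonal complement of \<open>q\<close>, so it determines \<open>q\<close> up to scale. The three
  members used are the cross products of \<open>q\<close> with the coordinate axes.\<close>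

lemma torus_plane_eq_imp_smult:
  assumes "torus_plane q = torus_plane r" "q \<in> S2" "r \<in> S2" "polar q x y \<noteq> 0"
  shows "r = smult (polar r x y / polar q x y) q"
proof -
  have "(coeff q 1, coeff q 0, 0) \<in> torus_plane q" "(0, coeff q 2, coeff q 1) \<in> torus_plane q"
    "(coeff q 2, 0, - coeff q 0) \<in> torus_plane q"
    by (auto simp: torus_plane_def)
  then have "(coeff q 1, coeff q 0, 0) \<in> torus_plane r" "(0, coeff q 2, coeff q 1) \<in> torus_plane r"
    "(coeff q 2, 0, - coeff q 0) \<in> torus_plane r"
    using assms(1) by simp_all
  then show ?thesis
    by (intro parallel_eq_smult assms) (auto simp: torus_plane_def algebra_simps)
qed

lemma torus_plane_smult: "c \<noteq> 0 \<Longrightarrow> torus_plane (smult c q) = torus_plane q"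
proof -
  assume "c \<noteq> 0"
  have "2 * (coeff (smult c q) 1 / 2) * t1 = coeff (smult c q) 2 * t2 + coeff (smult c q) 0 * t0
    \<longleftrightarrow> c * (2 * (coeff q 1 / 2) * t1) = c * (coeff q 2 * t2 + coeff q 0 * t0)" for t0 t1 t2
    by (simp add: algebra_simps)
  then show ?thesis
    using \<open>c \<noteq> 0\<close> unfolding torus_plane_def by simp
qed

lemma zero_in_torus_plane: "(0, 0, 0) \<in> torus_plane q"
  by (simp add: torus_plane_def)

lemma fst_ambitoric_metric: "fst (ambitoric_metric U q A B) = torus_plane q"
  by (simp add: ambitoric_metric_def)

lemma ambitoric_metric_outside: "z \<notin> U \<Longrightarrow> snd (ambitoric_metric U q A B) z v = 0"
  by (cases z; cases v) (auto simp: ambitoric_metric_def)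

lemma ambitoric_metric_dx:
  assumes "(x, y) \<in> U"
  shows "snd (ambitoric_metric U q A B) (x, y) (1, 0, (0, 0, 0)) = (x - y) / (polar q x y * A x)"
  using assms zero_in_torus_plane by (simp add: ambitoric_metric_def)

lemma ambitoric_metric_dy:
  assumes "(x, y) \<in> U"
  shows "snd (ambitoric_metric U q A B) (x, y) (0, 1, (0, 0, 0)) = (x - y) / (polar q x y * B y)"
  using assms zero_in_torus_plane by (simp add: ambitoric_metric_def)

text \<open>The coordinates of \<open>(z - x) ((q2 x + q1) z + (q1 x + q0))\<close>: the element of the torus plane
  on which the form multiplying \<open>B\<close> vanishes, scaled so that the form multiplying \<open>A\<close> takes the
  value \<open>- (x - y) q(x, y)\<close>.\<close>

definition root_vector :: "real poly \<Rightarrow> real \<Rightarrow> tvec" where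
  "root_vector q x =
     (let a = coeff q 2 * x + coeff q 1 / 2; b = coeff q 1 / 2 * x + coeff q 0
      in (a, (b - a * x) / 2, - b * x))"

lemma ambitoric_metric_root_vector:
  assumes "(x, y) \<in> U" "x > y" "c \<noteq> 0" "polar q x y \<noteq> 0"
  shows "snd (ambitoric_metric U (smult c q) A B) (x, y) (0, 0, root_vector q x)
    = (x - y) * A x / (c ^ 3 * polar q x y)"
proof -
  define a b where "a = coeff q 2 * x + coeff q 1 / 2" and "b = coeff q 1 / 2 * x + coeff q 0"
  have t: "root_vector q x = (a, (b - a * x) / 2, - b * x)"
    by (simp only: root_vector_def a_def b_def Let_def)
  have mem: "(a, (b - a * x) / 2, - b * x) \<in> torus_plane (smult c q)"
    unfolding torus_plane_smult[OF assms(3)]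
    by (simp add: torus_plane_def a_def b_def algebra_simps)
  have 1: "y\<^sup>2 * a + 2 * y * ((b - a * x) / 2) + - b * x = - ((x - y) * polar q x y)"
    by (simp add: a_def b_def polar_def field_simps power2_eq_square)
  have 2: "x\<^sup>2 * a + 2 * x * ((b - a * x) / 2) + - b * x = 0"
    by (simp add: field_simps power2_eq_square)
  have "snd (ambitoric_metric U (smult c q) A B) (x, y) (0, 0, root_vector q x)
    = (x - y) / (c * polar q x y) *
      (A x * (- ((x - y) * polar q x y) / ((x - y) * (c * polar q x y)))\<^sup>2)"
    unfolding ambitoric_metric_def t using assms(1) mem 1 2 by (simp add: polar_smult)
  also have "\<dots> = (x - y) * A x / (c ^ 3 * polar q x y)"
  proof -
    have "- ((x - y) * polar q x y) / ((x - y) * (c * polar q x y)) = - (1 / c)"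
      using assms(2-4) by simp
    then show ?thesis by (simp only:) (simp add: power2_eq_square power3_eq_cube)
  qed
  finally show ?thesis .
qed

text \<open>Write the second quadratic as \<open>c q\<close>. The \<open>dx\<^sup>2\<close> coefficients give \<open>A = c A'\<close>, while
  the angular part along \<open>root_vector\<close> gives \<open>A' = c\<^sup>3 A\<close>. So \<open>c\<^sup>4 = 1\<close>, which together with
  positivity rules out any rescaling.\<close>

lemma ambitoric_metric_inject:
  assumes "U \<noteq> {}" "\<And>x y. (x, y) \<in> U \<Longrightarrow> x > y"
    and data: "ambitoric_data U q A B" "ambitoric_data U q' A' B'"
    and eq: "ambitoric_metric U q A B = ambitoric_metric U q' A' B'"
  shows "q = q'" and "\<And>x y. (x, y) \<in> U \<Longrightarrow> A x = A' x \<and> B y = B' y"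
proof -
  obtain a b where ab: "(a, b) \<in> U" using assms(1) by auto
  have pos: "polar q x y > 0" "A x > 0" "B y > 0" "polar q' x y > 0" "A' x > 0" "B' y > 0"
    if "(x, y) \<in> U" for x y
    using data that by (auto simp: ambitoric_data_def)
  have S2: "q \<in> S2" "q' \<in> S2" using data by (auto simp: ambitoric_data_def)
  have plane: "torus_plane q = torus_plane q'" using eq by (simp add: ambitoric_metric_def)
  define c where "c = polar q' a b / polar q a b"
  have c: "c > 0" using pos[OF ab] by (simp add: c_def)
  have q': "q' = smult c q"
    unfolding c_def using torus_plane_eq_imp_smult[OF plane S2] pos(1)[OF ab] by simp
  have dx: "A x = c * A' x" if "(x, y) \<in> U" for x y
  proof -
    have "(x - y) / (polar q x y * A x) = (x - y) / (c * polar q x y * A' x)"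
      using ambitoric_metric_dx[OF that, of q A B] ambitoric_metric_dx[OF that, of q' A' B'] eq
      by (simp add: q' polar_smult)
    then show ?thesis using pos[OF that] assms(2)[OF that] c by (simp add: field_simps)
  qed
  have dy: "B y = c * B' y" if "(x, y) \<in> U" for x y
  proof -
    have "(x - y) / (polar q x y * B y) = (x - y) / (c * polar q x y * B' y)"
      using ambitoric_metric_dy[OF that, of q A B] ambitoric_metric_dy[OF that, of q' A' B'] eq
      by (simp add: q' polar_smult)
    then show ?thesis using pos[OF that] assms(2)[OF that] c by (simp add: field_simps)
  qed
  have "(a - b) * A a / polar q a b = (a - b) * A' a / (c ^ 3 * polar q a b)"
    using ambitoric_metric_root_vector[OF ab assms(2)[OF ab], of 1 q A B]
      ambitoric_metric_root_vector[OF ab assms(2)[OF ab], of c q A' B'] eq c pos[OF ab]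
    by (simp add: q')
  then have "(a - b) / polar q a b * A a = (a - b) / polar q a b * (A' a / c ^ 3)"
    by (simp add: mult.commute)
  moreover have "(a - b) / polar q a b \<noteq> 0"
    using pos(1)[OF ab] assms(2)[OF ab] by simp
  ultimately have "A a = A' a / c ^ 3"
    using mult_left_cancel by blast
  then have "c ^ 3 * A a = A' a" using c by simp
  then have "c ^ 4 * A' a = A' a"
    using dx[OF ab] by (simp add: power4_eq_xxxx power3_eq_cube algebra_simps)
  then have "c ^ 4 = 1" using pos[OF ab] by simp
  then have "c = 1" using c power_eq_iff_eq_base[of 4 c 1] by simp
  then show "q = q'" "\<And>x y. (x, y) \<in> U \<Longrightarrow> A x = A' x \<and> B y = B' y"
    using q' dx dy by auto
qed

lemma ambitoric_metric_poly_inject: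
  assumes "open U" "U \<noteq> {}" "\<And>x y. (x, y) \<in> U \<Longrightarrow> x > y"
    and data: "ambitoric_data U q (poly A) (poly B)" "ambitoric_data U q' (poly A') (poly B')"
    and eq: "ambitoric_metric U q (poly A) (poly B) = ambitoric_metric U q' (poly A') (poly B')"
  shows "q = q' \<and> A = A' \<and> B = B'"
proof -
  note inj = ambitoric_metric_inject[OF assms(2,3) data eq]
  obtain a b where ab: "(a, b) \<in> U" using assms(2) by auto
  then obtain e where e: "e > 0" "\<And>x y. \<bar>x - a\<bar> < e \<Longrightarrow> \<bar>y - b\<bar> < e \<Longrightarrow> (x, y) \<in> U"
    using open_contains_box[OF assms(1)] by metis
  have "A = A'"
    by (rule poly_eq_on_interval[OF e(1), of a]) (use e inj(2)[of _ b] in simp)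
  moreover have "B = B'"
    by (rule poly_eq_on_interval[OF e(1), of b]) (use e inj(2)[of a] in simp)
  ultimately show ?thesis using inj(1) by simp
qed

lemma sum_diff_poly_cancel:
  fixes p :: "real poly"
  assumes "p \<noteq> 0" "p * \<rho> + R = p * \<rho>' + R'" "p * \<rho> - R = p * \<rho>' - R'"
  shows "\<rho> = \<rho>' \<and> R = R'"
proof -
  have "2 * (p * (\<rho> - \<rho>')) = 0" using assms(2,3) by algebra
  then have "\<rho> = \<rho>'" using assms(1) by simp
  then show ?thesis using assms(2) by simp
qed

section \<open>The duality between the two kinds of data\<close>

text \<open>Both \<open>p\<close> and its transvectant with \<open>R\<close> are orthogonal to \<open>q\<close>, so their bracket is a multiple
  of \<open>q\<close>. This is why the scalar curvature of the Einstein--Maxwell metric is constant.\<close>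

lemma bracket_transvectant2_em:
  assumes "em_data U q p \<rho> R" "(a, b) \<in> U"
  shows "bracket p (transvectant2 p R) = smult (- em_scal q p R a b) q"
proof -
  have "p \<in> S2" "q \<in> S2" "transvectant2 p R \<in> S2" "pairing p q = 0"
    "pairing (transvectant2 p R) q = 0" "polar q a b \<noteq> 0"
    using assms transvectant2_S2 by (auto simp: em_data_def ambitoric_data_def)
  then show ?thesis
    using orthogonal_imp_parallel_bracket[of p "transvectant2 p R" q a b] by (simp add: em_scal_def)
qed

lemma em_scal_const:
  assumes "em_data U q p \<rho> R" "(a, b) \<in> U" "(x, y) \<in> U"
  shows "em_scal q p R x y = em_scal q p R a b"
proof -
  have "polar q x y > 0" using assms(1,3) by (auto simp: em_data_def ambitoric_data_def)
  then show ?thesis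
    by (subst em_scal_def) (simp add: bracket_transvectant2_em[OF assms(1,2)] polar_smult polar_uminus)
qed

lemma em_scal_1_imp_quadratic:
  assumes "em_data U q p \<rho> R" "\<forall>(x, y) \<in> U. em_scal q p R x y = 1" "U \<noteq> {}"
  shows "q = - bracket p (transvectant2 p R)"
proof -
  obtain a b where "(a, b) \<in> U" using assms(3) by auto
  then show ?thesis using bracket_transvectant2_em[OF assms(1), of a b] assms(2) by auto
qed

lemma em_imp_extremal_data: "em_data U q p \<rho> R \<Longrightarrow> extremal_data U p \<rho> R"
  by (auto simp: em_data_def extremal_data_def ambitoric_data_def)

lemma extremal_scal_normalised_em:
  assumes "em_data U q p \<rho> R" "\<forall>(x, y) \<in> U. em_scal q p R x y = 1" "U \<noteq> {}"
  shows "extremal_scal p R x y = polar q x y / polar p x y"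
proof -
  have "polar q x y = - polar (bracket p (transvectant2 p R)) x y"
    by (subst em_scal_1_imp_quadratic[OF assms]) (simp add: polar_uminus)
  then show ?thesis by (simp add: extremal_scal_def)
qed

text \<open>The inverse construction. The two orthogonality conditions on the new quadratic are the
  cross product identities, and its positivity is that of the scalar curvature.\<close>

lemma extremal_imp_em_data:
  assumes "extremal_data U p \<rho> R" "\<forall>(x, y) \<in> U. extremal_scal p R x y > 0"
  defines "q \<equiv> - bracket p (transvectant2 p R)"
  shows "em_data U q p \<rho> R" and "\<forall>(x, y) \<in> U. em_scal q p R x y = 1"
proof -
  have p: "p \<in> S2" "transvectant2 p R \<in> S2" and pos: "\<forall>(x, y) \<in> U. polar p x y > 0"
    using assms(1) transvectant2_S2 by (auto simp: extremal_data_def ambitoric_data_def)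
  have q: "polar q x y = - polar (bracket p (transvectant2 p R)) x y" for x y
    by (simp add: q_def polar_uminus)
  have qpos: "\<forall>(x, y) \<in> U. polar q x y > 0"
  proof clarify
    fix x y assume xy: "(x, y) \<in> U"
    then have "polar q x y / polar p x y > 0" "polar p x y > 0"
      using assms(2) pos by (auto simp: extremal_scal_def q)
    then show "polar q x y > 0" by (simp add: zero_less_divide_iff)
  qed
  have "q \<in> S2" using bracket_S2[OF p] by (simp add: q_def S2_def)
  then show "em_data U q p \<rho> R"
    using assms(1) pos qpos p pairing_bracket[OF p]
    by (auto simp: em_data_def extremal_data_def ambitoric_data_def q_def pairing_uminus_right)
  show "\<forall>(x, y) \<in> U. em_scal q p R x y = 1"
    using qpos by (auto simp: em_scal_def q)
qed

lemma extremal_metric_inject: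
  assumes "open U" "U \<noteq> {}" "\<And>x y. (x, y) \<in> U \<Longrightarrow> x > y"
    and data: "extremal_data U q \<pi> P" "extremal_data U q' \<pi>' P'"
    and eq: "extremal_metric U q \<pi> P = extremal_metric U q' \<pi>' P'"
  shows "q = q' \<and> \<pi> = \<pi>' \<and> P = P'"
proof -
  have inj: "q = q' \<and> q * \<pi> + P = q' * \<pi>' + P' \<and> q * \<pi> - P = q' * \<pi>' - P'"
    using data eq
    by (intro ambitoric_metric_poly_inject[OF assms(1-3)])
      (auto simp: extremal_data_def extremal_metric_def)
  moreover have "q \<noteq> 0"
    using data(1) assms(2) by (auto simp: extremal_data_def ambitoric_data_def polar_def)
  ultimately show ?thesis using sum_diff_poly_cancel[of q \<pi> P \<pi>' P'] by metis
qed

lemma killing_potential_pos: "em_data U q p \<rho> R \<Longrightarrow> z \<in> U \<Longrightarrow> killing_potential U q p z > 0"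
  by (cases z) (fastforce simp: em_data_def ambitoric_data_def killing_potential_def
      intro: divide_pos_pos)

text \<open>Away from \<open>U\<close> both tensors vanish by convention, so dividing by \<open>f\<^sup>2\<close> loses nothing.\<close>

lemma conformal_ambitoric_cancel:
  assumes "conformal f (ambitoric_metric U q A B) = conformal f (ambitoric_metric U q' A' B')"
    and "\<And>z. z \<in> U \<Longrightarrow> f z \<noteq> 0"
  shows "ambitoric_metric U q A B = ambitoric_metric U q' A' B'"
proof (rule prod_eqI)
  show "fst (ambitoric_metric U q A B) = fst (ambitoric_metric U q' A' B')"
    using assms(1) by (simp add: conformal_def)
  show "snd (ambitoric_metric U q A B) = snd (ambitoric_metric U q' A' B')"
  proof (intro ext)
    fix z v
    show "snd (ambitoric_metric U q A B) z v = snd (ambitoric_metric U q' A' B') z v"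
    proof (cases "z \<in> U")
      case True
      have "1 / (f z)\<^sup>2 * snd (ambitoric_metric U q A B) z v
        = 1 / (f z)\<^sup>2 * snd (ambitoric_metric U q' A' B') z v"
        using fun_cong[OF fun_cong[OF arg_cong[OF assms(1), of snd]], of z v]
        unfolding conformal_def snd_conv .
      then show ?thesis using assms(2)[OF True] by simp
    next
      case False
      then show ?thesis by (simp add: ambitoric_metric_outside)
    qed
  qed
qed

lemma killing_potential_inject:
  assumes "open U" "U \<noteq> {}" "p \<in> S2" "p' \<in> S2" "\<forall>(x, y) \<in> U. polar q x y > 0"
    and "killing_potential U q p = killing_potential U q p'"
  shows "p = p'"
proof (rule polar_eq_on_open[OF assms(1-4)])
  fix x y assume xy: "(x, y) \<in> U"
  then have "polar p x y / polar q x y = polar p' x y / polar q x y"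
    using fun_cong[OF assms(6), of "(x, y)"] by (simp add: killing_potential_def)
  moreover have "polar q x y > 0" using xy assms(5) by auto
  ultimately show "polar p x y = polar p' x y" by simp
qed

lemma em_pair_inject:
  assumes "open U" "U \<noteq> {}" "\<And>x y. (x, y) \<in> U \<Longrightarrow> x > y"
    and data: "em_data U q p \<rho> R" "em_data U q' p' \<rho>' R'"
    and eq: "em_pair U q p \<rho> R = em_pair U q' p' \<rho>' R'"
  shows "q = q' \<and> p = p' \<and> \<rho> = \<rho>' \<and> R = R'"
proof -
  have f: "killing_potential U q p = killing_potential U q' p'"
    using eq by (simp add: em_pair_def)
  have "em_kahler_metric U q p \<rho> R = em_kahler_metric U q' p' \<rho>' R'"
    using eq killing_potential_pos[OF data(1)] unfolding em_kahler_metric_def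
    by (intro conformal_ambitoric_cancel[where f = "killing_potential U q p"])
      (auto simp: em_pair_def em_kahler_metric_def less_le)
  then have inj: "q = q' \<and> p * \<rho> + R = p' * \<rho>' + R' \<and> p * \<rho> - R = p' * \<rho>' - R'"
    using data
    by (intro ambitoric_metric_poly_inject[OF assms(1-3)])
      (auto simp: em_data_def em_kahler_metric_def)
  have p: "p = p'"
    using f data inj by (intro killing_potential_inject[OF assms(1,2)])
      (auto simp: em_data_def ambitoric_data_def)
  moreover have "p \<noteq> 0"
    using data(1) assms(2) by (auto simp: em_data_def polar_def)
  ultimately show ?thesis using inj sum_diff_poly_cancel[of p \<rho> R \<rho>' R'] by metis
qed

section \<open>Constant Killing potentials\<close>

lemma const_killing_potential_imp_smult:
  assumes "open U" "V \<subseteq> U" "open V" "V \<noteq> {}" "em_data U q p \<rho> R"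
    and "\<And>z. z \<in> V \<Longrightarrow> killing_potential U q p z = c"
  shows "p = smult c q"
proof (rule polar_eq_on_open[OF assms(3,4)])
  show "p \<in> S2" "smult c q \<in> S2"
    using assms(5) S2_smult by (auto simp: em_data_def ambitoric_data_def)
  fix x y assume xy: "(x, y) \<in> V"
  then have "polar q x y > 0" "polar p x y / polar q x y = c"
    using assms(2,5) assms(6)[OF xy]
    by (auto simp: em_data_def ambitoric_data_def killing_potential_def)
  then show "polar p x y = polar (smult c q) x y" by (auto simp: polar_smult)
qed

lemma scaleR_in_torus_plane:
  assumes "c \<noteq> 0"
  shows "c *\<^sub>R t \<in> torus_plane q \<longleftrightarrow> t \<in> torus_plane q"
proof -
  obtain t0 t1 t2 where t: "t = (t0, t1, t2)" by (cases t)
  have "2 * (coeff q 1 / 2) * (c * t1) = coeff q 2 * (c * t2) + coeff q 0 * (c * t0)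
    \<longleftrightarrow> c * (2 * (coeff q 1 / 2) * t1) = c * (coeff q 2 * t2 + coeff q 0 * t0)"
    by (simp add: algebra_simps)
  then show ?thesis using assms by (simp add: t torus_plane_def)
qed

text \<open>The two rescalings of data behind constant potentials. Replacing \<open>q\<close> by \<open>c q\<close> divides the
  conformal factor and the angular forms by \<open>c\<close>. Scaling the angular coordinates by \<open>c\<close> undoes the
  latter and leaves \<open>1/c\<close>; scaling \<open>A\<close> and \<open>B\<close> by \<open>c\<close> instead multiplies all four summands by
  \<open>1/c\<close>, which gives \<open>1/c\<^sup>2\<close> in total.\<close>

lemma ambitoric_metric_smult_scaled:
  assumes "c > 0"
  shows "snd (ambitoric_metric U (smult c q) A B) z (dx, dy, c *\<^sub>R t)
    = 1 / c * snd (ambitoric_metric U q A B) z (dx, dy, t)"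
proof -
  obtain x y where z: "z = (x, y)" by (cases z)
  obtain t0 t1 t2 where t: "t = (t0, t1, t2)" by (cases t)
  have plane: "torus_plane (smult c q) = torus_plane q"
    using assms by (simp add: torus_plane_smult)
  have mem: "(c * t0, c * t1, c * t2) \<in> torus_plane q \<longleftrightarrow> (t0, t1, t2) \<in> torus_plane q"
    using scaleR_in_torus_plane[of c t q] assms by (simp add: t)
  have canc: "(u\<^sup>2 * (c * t0) + 2 * u * (c * t1) + c * t2) / ((x - y) * (c * Q))
    = (u\<^sup>2 * t0 + 2 * u * t1 + t2) / ((x - y) * Q)" for u Q
  proof -
    have "(u\<^sup>2 * (c * t0) + 2 * u * (c * t1) + c * t2) / ((x - y) * (c * Q))
      = (c * (u\<^sup>2 * t0 + 2 * u * t1 + t2)) / (c * ((x - y) * Q))"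
      by (simp add: algebra_simps)
    then show ?thesis using assms by simp
  qed
  show ?thesis
    unfolding ambitoric_metric_def z t plane
    by (simp add: mem polar_smult canc)
qed

lemma ambitoric_metric_smult_smult:
  assumes "c > 0"
  shows "ambitoric_metric U (smult c q) (\<lambda>x. c * A x) (\<lambda>y. c * B y)
    = conformal (\<lambda>_. c) (ambitoric_metric U q A B)"
proof -
  have plane: "torus_plane (smult c q) = torus_plane q"
    using assms by (simp add: torus_plane_smult)
  have "w / (c * Q) * (a / (c * F) + b / (c * G) + c * F * (u / (w * (c * Q)))\<^sup>2
      + c * G * (v / (w * (c * Q)))\<^sup>2)
    = 1 / c\<^sup>2 * (w / Q * (a / F + b / G + F * (u / (w * Q))\<^sup>2 + G * (v / (w * Q))\<^sup>2))"
    for w Q a b F G u v :: real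
  proof -
    have "c * H * (u / (w * (c * Q)))\<^sup>2 = 1 / c * (H * (u / (w * Q))\<^sup>2)" for H u
      using assms by (simp add: power_divide power_mult_distrib power2_eq_square)
    then have "a / (c * F) + b / (c * G) + c * F * (u / (w * (c * Q)))\<^sup>2
        + c * G * (v / (w * (c * Q)))\<^sup>2
      = 1 / c * (a / F + b / G + F * (u / (w * Q))\<^sup>2 + G * (v / (w * Q))\<^sup>2)"
      by (simp add: distrib_left)
    then show ?thesis by (simp add: power2_eq_square)
  qed
  then show ?thesis
    by (auto simp: ambitoric_metric_def conformal_def plane polar_smult fun_eq_iff)
qed

text \<open>If \<open>p = c q\<close>, then scaling the angular coordinates by \<open>c\<close> turns the metric defined by \<open>p\<close> into a
  constant multiple of that defined by \<open>q\<close>. Conversely the \<open>dx\<^sup>2\<close> coefficients of homothetic metrics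
  with the same \<open>A\<close> have ratio \<open>p(x, y)/q(x, y)\<close>.\<close>

lemma homothetic_iff_const_killing_potential:
  assumes "open U" "U \<noteq> {}" "\<And>x y. (x, y) \<in> U \<Longrightarrow> x > y" "em_data U q p \<rho> R"
  shows "homothetic U (em_kahler_metric U q p \<rho> R) (extremal_metric U p \<rho> R)
    \<longleftrightarrow> (\<exists>c. \<forall>z \<in> U. killing_potential U q p z = c)"
proof
  let ?A = "poly (p * \<rho> + R)" and ?B = "poly (p * \<rho> - R)"
  have pos: "polar q x y > 0" "polar p x y > 0" "?A x > 0" if "(x, y) \<in> U" for x y
    using assms(4) that by (auto simp: em_data_def ambitoric_data_def)
  assume "homothetic U (em_kahler_metric U q p \<rho> R) (extremal_metric U p \<rho> R)"
  then obtain k L where kL: "k > 0" "linear L"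
    "\<And>z dx dy t. z \<in> U \<Longrightarrow> t \<in> torus_plane q \<Longrightarrow>
      snd (ambitoric_metric U q ?A ?B) z (dx, dy, t)
      = k * snd (ambitoric_metric U p ?A ?B) z (dx, dy, L t)"
    unfolding homothetic_def em_kahler_metric_def extremal_metric_def fst_ambitoric_metric
    by blast
  have "killing_potential U q p (x, y) = k" if xy: "(x, y) \<in> U" for x y
  proof -
    have "(x - y) / (polar q x y * ?A x) = k * ((x - y) / (polar p x y * ?A x))"
      using kL(3)[OF xy zero_in_torus_plane, of 1 0] linear_0[OF kL(2)]
        ambitoric_metric_dx[OF xy, of q ?A ?B] ambitoric_metric_dx[OF xy, of p ?A ?B]
      by (simp add: zero_prod_def)
    then have "1 / polar q x y = k * (1 / polar p x y)"
      using pos(3)[OF xy] assms(3)[OF xy] by (simp add: divide_simps split: if_splits)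
    then show ?thesis
      using pos[OF xy] xy by (simp add: killing_potential_def field_simps)
  qed
  then show "\<exists>c. \<forall>z \<in> U. killing_potential U q p z = c" by auto
next
  assume "\<exists>c. \<forall>z \<in> U. killing_potential U q p z = c"
  then obtain c where c: "\<And>z. z \<in> U \<Longrightarrow> killing_potential U q p z = c" by auto
  have p: "p = smult c q"
    using const_killing_potential_imp_smult[OF assms(1) order_refl assms(1,2,4) c] .
  have "c > 0" using c killing_potential_pos[OF assms(4)] assms(2) by fastforce
  then have plane: "torus_plane p = torus_plane q" using p torus_plane_smult by simp
  define L :: "tvec \<Rightarrow> tvec" where "L = (\<lambda>t. c *\<^sub>R t)"
  have "linear L" unfolding L_def by (simp add: linear_iff scaleR_add_right)
  moreover have "bij_betw L (torus_plane q) (torus_plane p)"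
    unfolding plane L_def
    by (rule bij_betw_byWitness[where f' = "\<lambda>t. (1 / c) *\<^sub>R t"])
      (use \<open>c > 0\<close> scaleR_in_torus_plane[of c] scaleR_in_torus_plane[of "1 / c"] in auto)
  moreover have "snd (em_kahler_metric U q p \<rho> R) z (dx, dy, t)
      = c * snd (extremal_metric U p \<rho> R) z (dx, dy, L t)" for z dx dy t
    using ambitoric_metric_smult_scaled[OF \<open>c > 0\<close>, of U q "poly (p * \<rho> + R)" "poly (p * \<rho> - R)"]
      \<open>c > 0\<close>
    unfolding em_kahler_metric_def extremal_metric_def L_def p[symmetric] by simp
  ultimately show "homothetic U (em_kahler_metric U q p \<rho> R) (extremal_metric U p \<rho> R)"
    unfolding homothetic_def using \<open>c > 0\<close>
    by (intro exI[of _ c] conjI exI[of _ L])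
      (auto simp: em_kahler_metric_def extremal_metric_def fst_ambitoric_metric)
qed

lemma em_kahler_eq_extremal_iff:
  assumes "open U" "U \<noteq> {}" "\<And>x y. (x, y) \<in> U \<Longrightarrow> x > y" "em_data U q p \<rho> R"
  shows "em_kahler_metric U q p \<rho> R = extremal_metric U p \<rho> R
    \<longleftrightarrow> (\<forall>z \<in> U. killing_potential U q p z = 1)"
proof
  assume "em_kahler_metric U q p \<rho> R = extremal_metric U p \<rho> R"
  then have "q = p"
    using assms(4) em_imp_extremal_data[OF assms(4)]
      ambitoric_metric_poly_inject[OF assms(1-3), of q "p * \<rho> + R" "p * \<rho> - R" p
        "p * \<rho> + R" "p * \<rho> - R"]
    unfolding em_kahler_metric_def extremal_metric_def em_data_def extremal_data_def by blast
  then show "\<forall>z \<in> U. killing_potential U q p z = 1"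
    using assms(4) by (auto simp: killing_potential_def em_data_def)
next
  assume "\<forall>z \<in> U. killing_potential U q p z = 1"
  then have "p = smult 1 q"
    by (intro const_killing_potential_imp_smult[OF assms(1) order_refl assms(1,2,4)]) auto
  then show "em_kahler_metric U q p \<rho> R = extremal_metric U p \<rho> R"
    by (simp add: em_kahler_metric_def extremal_metric_def)
qed

text \<open>If \<open>f = c\<close>, so \<open>p = c q\<close>, then \<open>1/c\<^sup>2 g\<close> is the extremal metric defined by \<open>p\<close>, \<open>c A\<close>, \<open>c B\<close>, whose scalar
  curvature is \<open>c q(x, y)/p(x, y) = 1\<close>.
  Conversely, if \<open>1/f\<^sup>2 g\<close> is itself a metric defined by \<open>(q', A', B')\<close>, then \<open>q'\<close> is a multiple \<open>\<alpha> q\<close>,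
  since the torus planes agree, and the \<open>dx\<^sup>2\<close> and \<open>dy\<^sup>2\<close> coefficients give
  \<open>f\<^sup>2 = \<alpha> A'(x)/A(x) = \<alpha> B'(y)/B(y)\<close>: a function of \<open>x\<close> alone and of \<open>y\<close> alone. So \<open>f\<close> is constant
  on a box, and then on all of \<open>U\<close>, connected or not, because \<open>p - c q\<close> is determined by its values
  there.\<close>

lemma cscK_iff_const_killing_potential:
  assumes "open U" "U \<noteq> {}" "\<And>x y. (x, y) \<in> U \<Longrightarrow> x > y" "em_data U q p \<rho> R"
    and "\<forall>(x, y) \<in> U. em_scal q p R x y = 1"
  shows "(\<exists>c. \<forall>z \<in> U. killing_potential U q p z = c)
    \<longleftrightarrow> conformal (killing_potential U q p) (em_kahler_metric U q p \<rho> R) \<in> cscK_metrics U"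
proof
  let ?f = "killing_potential U q p"
  assume "\<exists>c. \<forall>z \<in> U. ?f z = c"
  then obtain c where c: "\<And>z. z \<in> U \<Longrightarrow> ?f z = c" by auto
  have p: "p = smult c q"
    using const_killing_potential_imp_smult[OF assms(1) order_refl assms(1,2,4) c] .
  have c0: "c > 0" using c killing_potential_pos[OF assms(4)] assms(2) by fastforce
  then have plane: "torus_plane p = torus_plane q" using p torus_plane_smult by simp
  have AB: "p * smult c \<rho> + smult c R = smult c (p * \<rho> + R)"
    "p * smult c \<rho> - smult c R = smult c (p * \<rho> - R)"
    by (simp_all add: smult_add_right smult_diff_right)
  have "extremal_data U p (smult c \<rho>) (smult c R)"
    using em_imp_extremal_data[OF assms(4)] c0
    unfolding extremal_data_def ambitoric_data_def AB
    by (auto simp: S2_smult pairing_smult_left)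
  moreover have "extremal_scal p (smult c R) x y = 1" if xy: "(x, y) \<in> U" for x y
  proof -
    have "extremal_scal p (smult c R) x y = c * extremal_scal p R x y"
      by (simp add: extremal_scal_def transvectant2_smult bracket_smult polar_smult)
    also have "\<dots> = c * (polar q x y / polar p x y)"
      by (simp add: extremal_scal_normalised_em[OF assms(4,5,2)])
    also have "\<dots> = 1"
      using c[OF xy] c0 xy by (auto simp: killing_potential_def)
    finally show ?thesis .
  qed
  moreover have "conformal ?f (em_kahler_metric U q p \<rho> R)
    = extremal_metric U p (smult c \<rho>) (smult c R)"
  proof -
    have "conformal ?f (em_kahler_metric U q p \<rho> R)
      = conformal (\<lambda>_. c) (em_kahler_metric U q p \<rho> R)"
      using c unfolding conformal_def em_kahler_metric_def
      by (auto simp: fun_eq_iff) (metis ambitoric_metric_outside mult_zero_right)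
    also have "\<dots> = ambitoric_metric U (smult c q) (\<lambda>x. c * poly (p * \<rho> + R) x)
        (\<lambda>y. c * poly (p * \<rho> - R) y)"
      unfolding em_kahler_metric_def by (rule ambitoric_metric_smult_smult[OF c0, symmetric])
    also have "\<dots> = extremal_metric U p (smult c \<rho>) (smult c R)"
      unfolding extremal_metric_def AB p[symmetric] poly_smult[symmetric] ..
    finally show ?thesis .
  qed
  ultimately show "conformal ?f (em_kahler_metric U q p \<rho> R) \<in> cscK_metrics U"
    unfolding cscK_metrics_def by blast
next
  let ?f = "killing_potential U q p" and ?A = "poly (p * \<rho> + R)" and ?B = "poly (p * \<rho> - R)"
  assume "conformal ?f (em_kahler_metric U q p \<rho> R) \<in> cscK_metrics U"
  then obtain q' \<pi> P where e: "extremal_data U q' \<pi> P"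
    and eq: "conformal ?f (em_kahler_metric U q p \<rho> R) = extremal_metric U q' \<pi> P"
    unfolding cscK_metrics_def by blast
  let ?A' = "poly (q' * \<pi> + P)" and ?B' = "poly (q' * \<pi> - P)"
  have pos: "polar q x y > 0" "?A x > 0" "?B y > 0" "polar q' x y > 0" "?A' x > 0" "?B' y > 0"
    "?f (x, y) > 0" if "(x, y) \<in> U" for x y
    using assms(4) e that killing_potential_pos[OF assms(4)]
    by (auto simp: em_data_def extremal_data_def ambitoric_data_def)
  have S2: "q \<in> S2" "q' \<in> S2"
    using assms(4) e by (auto simp: em_data_def extremal_data_def ambitoric_data_def)
  obtain a b where ab: "(a, b) \<in> U" using assms(2) by auto
  have "torus_plane q = torus_plane q'"
    using arg_cong[OF eq, of fst]
    by (simp add: conformal_def em_kahler_metric_def extremal_metric_def ambitoric_metric_def)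
  then obtain \<alpha> where q': "q' = smult \<alpha> q"
    using torus_plane_eq_imp_smult[of q q' a b] S2 pos(1)[OF ab] by auto
  have comp: "1 / (?f z)\<^sup>2 * snd (ambitoric_metric U q ?A ?B) z v
    = snd (ambitoric_metric U q' ?A' ?B') z v" for z v
    using fun_cong[OF fun_cong[OF arg_cong[OF eq, of snd]], of z v]
    unfolding conformal_def em_kahler_metric_def extremal_metric_def snd_conv .
  have solve: "F = \<alpha> * a' / a"
    if "1 / F * (w / (Q * a)) = w / (\<alpha> * Q * a')" "F > 0" "w > 0" "Q > 0" "a > 0" "a' > 0"
      "\<alpha> * Q > 0" for F w Q a a' :: real
  proof -
    have "\<alpha> > 0" using that by (simp add: zero_less_mult_iff)
    have "w * (\<alpha> * Q * a') = w * (F * (Q * a))"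
      using that \<open>\<alpha> > 0\<close> by (simp add: frac_eq_eq)
    then have "\<alpha> * a' = F * a" using that by simp
    then show ?thesis using that by (simp add: field_simps)
  qed
  have fx: "(?f (x, y))\<^sup>2 = \<alpha> * ?A' x / ?A x" if xy: "(x, y) \<in> U" for x y
    using comp[of "(x, y)" "(1, 0, (0, 0, 0))"] pos[OF xy] assms(3)[OF xy]
    by (intro solve[of _ "x - y" "polar q x y"])
      (simp_all only: ambitoric_metric_dx[OF xy] q' polar_smult zero_less_power diff_gt_0_iff_gt)
  have fy: "(?f (x, y))\<^sup>2 = \<alpha> * ?B' y / ?B y" if xy: "(x, y) \<in> U" for x y
    using comp[of "(x, y)" "(0, 1, (0, 0, 0))"] pos[OF xy] assms(3)[OF xy]
    by (intro solve[of _ "x - y" "polar q x y"])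
      (simp_all only: ambitoric_metric_dy[OF xy] q' polar_smult zero_less_power diff_gt_0_iff_gt)
  obtain d where d: "d > 0" "\<And>x y. \<bar>x - a\<bar> < d \<Longrightarrow> \<bar>y - b\<bar> < d \<Longrightarrow> (x, y) \<in> U"
    using open_contains_box[OF assms(1) ab] by metis
  define V where "V = {a - d<..<a + d} \<times> {b - d<..<b + d}"
  have V: "V \<subseteq> U" "open V" "V \<noteq> {}"
    using d by (auto simp: V_def open_Times)
  have "?f z = ?f (a, b)" if "z \<in> V" for z
  proof -
    obtain x y where z: "z = (x, y)" by (cases z)
    have in_U: "(x, y) \<in> U" "(x, b) \<in> U"
      using that d by (auto simp: V_def z)
    have "(?f (x, y))\<^sup>2 = (?f (x, b))\<^sup>2" using fx in_U by simp
    also have "\<dots> = (?f (a, b))\<^sup>2" using fy[OF in_U(2)] fy[OF ab] by simp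
    finally show ?thesis
      using pos(7)[OF in_U(1)] pos(7)[OF ab] by (simp add: z power2_eq_iff)
  qed
  then have "p = smult (?f (a, b)) q"
    using const_killing_potential_imp_smult[OF assms(1) V assms(4)] by blast
  then have "polar p x y = ?f (a, b) * polar q x y" for x y
    by (metis polar_smult)
  then have "?f (x, y) = ?f (a, b)" if "(x, y) \<in> U" for x y
    using pos(1)[OF that] that by (subst killing_potential_def) simp
  then show "\<exists>c. \<forall>z \<in> U. ?f z = c" by auto
qed

section \<open>The correspondence\<close>

text \<open>Multiplying \<open>f\<close> by \<open>k\<close> replaces \<open>(p, \<rho>, R)\<close> by \<open>(k p, \<rho>/k, R)\<close>, which leaves \<open>g\<close> alone and multiplies
  the scalar curvature by \<open>k\<^sup>2\<close>.\<close>

lemma em_data_rescale: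
  assumes "em_data U q p \<rho> R" "k > 0"
  shows "em_data U q (smult k p) (smult (1 / k) \<rho>) R"
    and "em_pair U q (smult k p) (smult (1 / k) \<rho>) R
      = (conformal (\<lambda>z. k * killing_potential U q p z) (em_kahler_metric U q p \<rho> R),
         \<lambda>z. k * killing_potential U q p z)"
    and "em_scal q (smult k p) R x y = k\<^sup>2 * em_scal q p R x y"
proof -
  have prod: "smult k p * smult (1 / k) \<rho> = p * \<rho>" using assms(2) by simp
  show "em_data U q (smult k p) (smult (1 / k) \<rho>) R"
    using assms unfolding em_data_def prod
    by (auto simp: S2_smult pairing_smult_left pairing_smult_right polar_smult transvectant2_smult)
  have "killing_potential U q (smult k p) = (\<lambda>z. k * killing_potential U q p z)"
    by (auto simp: killing_potential_def polar_smult)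
  then show "em_pair U q (smult k p) (smult (1 / k) \<rho>) R
      = (conformal (\<lambda>z. k * killing_potential U q p z) (em_kahler_metric U q p \<rho> R),
         \<lambda>z. k * killing_potential U q p z)"
    unfolding em_pair_def em_kahler_metric_def prod by simp
  show "em_scal q (smult k p) R x y = k\<^sup>2 * em_scal q p R x y"
    by (simp add: em_scal_def transvectant2_smult bracket_smult polar_smult power2_eq_square)
qed

lemma normalised_em_pairs_iff:
  assumes "open U" "U \<noteq> {}" "\<And>x y. (x, y) \<in> U \<Longrightarrow> x > y" "em_data U q p \<rho> R"
  shows "em_pair U q p \<rho> R \<in> normalised_em_pairs U \<longleftrightarrow> (\<forall>(x, y) \<in> U. em_scal q p R x y = 1)"
proof
  assume "em_pair U q p \<rho> R \<in> normalised_em_pairs U"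
  then obtain q' p' \<rho>' R' where "em_pair U q p \<rho> R = em_pair U q' p' \<rho>' R'"
    "em_data U q' p' \<rho>' R'" "\<forall>(x, y) \<in> U. em_scal q' p' R' x y = 1"
    unfolding normalised_em_pairs_def by blast
  then show "\<forall>(x, y) \<in> U. em_scal q p R x y = 1"
    using em_pair_inject[OF assms(1-4)] by metis
qed (use assms(4) in \<open>auto simp: normalised_em_pairs_def\<close>)

lemma ex1_normalising_factor:
  assumes "open U" "U \<noteq> {}" "\<And>x y. (x, y) \<in> U \<Longrightarrow> x > y" "em_data U q p \<rho> R"
    and "\<forall>(x, y) \<in> U. em_scal q p R x y > 0"
  shows "\<exists>!k. k > 0 \<and>
    (conformal (\<lambda>z. k * killing_potential U q p z) (em_kahler_metric U q p \<rho> R),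
     \<lambda>z. k * killing_potential U q p z) \<in> normalised_em_pairs U"
proof -
  obtain a b where ab: "(a, b) \<in> U" using assms(2) by auto
  define s where "s = em_scal q p R a b"
  have const: "em_scal q p R x y = s" if "(x, y) \<in> U" for x y
    using em_scal_const[OF assms(4) ab that] by (simp add: s_def)
  have "s > 0" using ab assms(5) by (auto simp: s_def)
  have iff: "(conformal (\<lambda>z. k * killing_potential U q p z) (em_kahler_metric U q p \<rho> R),
      \<lambda>z. k * killing_potential U q p z) \<in> normalised_em_pairs U \<longleftrightarrow> k = 1 / sqrt s"
    if "k > 0" for k
  proof -
    have "(\<forall>(x, y) \<in> U. em_scal q (smult k p) R x y = 1) \<longleftrightarrow> k\<^sup>2 * s = 1"
      using ab const unfolding em_data_rescale(3)[OF assms(4) that] by auto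
    also have "\<dots> \<longleftrightarrow> (k * sqrt s)\<^sup>2 = 1"
      using \<open>s > 0\<close> by (simp add: power_mult_distrib)
    also have "\<dots> \<longleftrightarrow> k * sqrt s = 1"
      using mult_pos_pos[OF that, of "sqrt s"] \<open>s > 0\<close> unfolding power2_eq_1_iff by fastforce
    also have "\<dots> \<longleftrightarrow> k = 1 / sqrt s"
      using \<open>s > 0\<close> by (simp add: field_simps)
    finally show ?thesis
      using normalised_em_pairs_iff[OF assms(1-3) em_data_rescale(1)[OF assms(4) that]]
      unfolding em_data_rescale(2)[OF assms(4) that] by simp
  qed
  have "1 / sqrt s > 0" using \<open>s > 0\<close> by simp
  then show ?thesis using iff by blast
qed

text \<open>Both equations say that \<open>q(x, y)\<close> is minus the polarised bracket of \<open>p\<close> and its transvectant.\<close>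

lemma potential_eq_inverse_scal_iff:
  assumes "em_data U q p \<rho> R"
  shows "(\<forall>(x, y) \<in> U. killing_potential U q p (x, y) = 1 / extremal_scal p R x y)
    \<longleftrightarrow> (\<forall>(x, y) \<in> U. em_scal q p R x y = 1)"
proof -
  have *: "P / Q = 1 / (- W / P) \<longleftrightarrow> - W / Q = 1" if "P > 0" "Q > 0" for P Q W :: real
  proof (cases "W = 0")
    case False
    have *: "P / Q = 1 / (- W / P) \<longleftrightarrow> P / Q = P / (- W)" by simp
    also have "\<dots> \<longleftrightarrow> P * (- W) = P * Q"
      by (rule frac_eq_eq) (use that False in auto)
    also have "\<dots> \<longleftrightarrow> - W = Q"
      by (rule mult_left_cancel) (use that in auto)
    also have "\<dots> \<longleftrightarrow> - W / Q = 1"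
      using that by (simp only: divide_eq_1_iff) auto
    finally show ?thesis .
  qed (use that in simp)
  have "killing_potential U q p (x, y) = 1 / extremal_scal p R x y \<longleftrightarrow> em_scal q p R x y = 1"
    if "(x, y) \<in> U" for x y
  proof -
    have "polar p x y > 0" "polar q x y > 0"
      using assms that by (auto simp: em_data_def ambitoric_data_def)
    then show ?thesis
      using *[of "polar p x y" "polar q x y" "polar (bracket p (transvectant2 p R)) x y"] that
      by (simp add: killing_potential_def extremal_scal_def em_scal_def)
  qed
  then show ?thesis by auto
qed

text \<open>The correspondence \<open>(q, p, \<rho>, R) \<mapsto> (p, \<rho>, R)\<close> is well defined on metrics because an
  Einstein--Maxwell pair determines its data, and injective because an extremal metric determines
  \<open>(p, \<rho>, R)\<close>, from which the normalisation recovers \<open>q\<close>.\<close>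

lemma ex_correspondence:
  assumes "open U" "U \<noteq> {}" "\<And>x y. (x, y) \<in> U \<Longrightarrow> x > y"
  obtains \<Phi> where "bij_betw \<Phi> (normalised_em_pairs U) (positive_extremal_metrics U)"
    and "\<And>q p \<rho> R. em_data U q p \<rho> R \<Longrightarrow> (\<forall>(x, y) \<in> U. em_scal q p R x y = 1)
      \<Longrightarrow> \<Phi> (em_pair U q p \<rho> R) = extremal_metric U p \<rho> R"
proof
  define rel where "rel z h \<longleftrightarrow> (\<exists>q p \<rho> R. em_data U q p \<rho> R \<and> (\<forall>(x, y) \<in> U. em_scal q p R x y = 1)
    \<and> z = em_pair U q p \<rho> R \<and> h = extremal_metric U p \<rho> R)" for z h
  define \<Phi> where "\<Phi> z = (THE h. rel z h)" for z
  show \<Phi>: "\<Phi> (em_pair U q p \<rho> R) = extremal_metric U p \<rho> R"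
    if "em_data U q p \<rho> R" "\<forall>(x, y) \<in> U. em_scal q p R x y = 1" for q p \<rho> R
    unfolding \<Phi>_def
  proof (rule the_equality)
    show "rel (em_pair U q p \<rho> R) (extremal_metric U p \<rho> R)"
      using that unfolding rel_def by blast
    show "h = extremal_metric U p \<rho> R" if "rel (em_pair U q p \<rho> R) h" for h
      using that em_pair_inject[OF assms \<open>em_data U q p \<rho> R\<close>] unfolding rel_def by metis
  qed
  show "bij_betw \<Phi> (normalised_em_pairs U) (positive_extremal_metrics U)"
    unfolding bij_betw_def
  proof
    show "inj_on \<Phi> (normalised_em_pairs U)"
    proof (rule inj_onI)
      fix z z' assume "z \<in> normalised_em_pairs U" "z' \<in> normalised_em_pairs U" "\<Phi> z = \<Phi> z'"
      then obtain q p \<rho> R q' p' \<rho>' R' where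
        z: "z = em_pair U q p \<rho> R" "em_data U q p \<rho> R" "\<forall>(x, y) \<in> U. em_scal q p R x y = 1" and
        z': "z' = em_pair U q' p' \<rho>' R'" "em_data U q' p' \<rho>' R'"
          "\<forall>(x, y) \<in> U. em_scal q' p' R' x y = 1"
        unfolding normalised_em_pairs_def by blast
      have "p = p' \<and> \<rho> = \<rho>' \<and> R = R'"
        using \<open>\<Phi> z = \<Phi> z'\<close> z z' \<Phi>
        by (intro extremal_metric_inject[OF assms] em_imp_extremal_data) auto
      moreover have "q = q'"
        using em_scal_1_imp_quadratic[OF z(2,3) assms(2)]
          em_scal_1_imp_quadratic[OF z'(2,3) assms(2)] calculation by simp
      ultimately show "z = z'" using z(1) z'(1) by simp
    qed
    show "\<Phi> ` normalised_em_pairs U = positive_extremal_metrics U"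
    proof
      show "\<Phi> ` normalised_em_pairs U \<subseteq> positive_extremal_metrics U"
      proof
        fix h assume "h \<in> \<Phi> ` normalised_em_pairs U"
        then obtain q p \<rho> R where em: "em_data U q p \<rho> R" "\<forall>(x, y) \<in> U. em_scal q p R x y = 1"
          and h: "h = \<Phi> (em_pair U q p \<rho> R)"
          unfolding normalised_em_pairs_def by blast
        have "\<forall>(x, y) \<in> U. extremal_scal p R x y > 0"
          unfolding extremal_scal_normalised_em[OF em assms(2)]
          using em(1) by (auto simp: em_data_def ambitoric_data_def intro!: divide_pos_pos)
        then show "h \<in> positive_extremal_metrics U"
          using em_imp_extremal_data[OF em(1)] unfolding h \<Phi>[OF em] positive_extremal_metrics_def
          by blast
      qed
      show "positive_extremal_metrics U \<subseteq> \<Phi> ` normalised_em_pairs U"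
      proof
        fix h assume "h \<in> positive_extremal_metrics U"
        then obtain p \<rho> R where h: "h = extremal_metric U p \<rho> R" "extremal_data U p \<rho> R"
          "\<forall>(x, y) \<in> U. extremal_scal p R x y > 0"
          unfolding positive_extremal_metrics_def by blast
        note em = extremal_imp_em_data[OF h(2,3)]
        show "h \<in> \<Phi> ` normalised_em_pairs U"
          unfolding h(1) \<Phi>[OF em, symmetric] normalised_em_pairs_def using em by blast
      qed
    qed
  qed
qed

theorem proposition3:
  fixes U :: "(real \<times> real) set"
  assumes "open U" and "U \<noteq> {}" and "\<forall>(x, y) \<in> U. x > y"
  shows
    "(\<exists>\<Phi>. bij_betw \<Phi> (normalised_em_pairs U) (positive_extremal_metrics U)
      \<and> (\<forall>q p \<rho> R qb \<pi> P f g gt gb.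
           em_data U q p \<rho> R \<and> (\<forall>(x, y) \<in> U. em_scal q p R x y = 1)
           \<and> f = killing_potential U q p \<and> g = em_kahler_metric U q p \<rho> R \<and> gt = conformal f g
           \<and> extremal_data U qb \<pi> P \<and> gb = extremal_metric U qb \<pi> P
           \<and> \<Phi> (gt, f) = gb
           \<longrightarrow> (\<forall>(x, y) \<in> U. f (x, y) = 1 / extremal_scal qb P x y)
             \<and> qb = p \<and> qb * \<pi> + P = p * \<rho> + R \<and> qb * \<pi> - P = p * \<rho> - R
             \<and> (\<forall>(x, y) \<in> U. polar q x y = extremal_scal qb P x y * polar qb x y)
             \<and> (homothetic U g gb \<longleftrightarrow> (\<exists>c. \<forall>z \<in> U. f z = c))
             \<and> (g = gb \<longleftrightarrow> (\<forall>z \<in> U. f z = 1))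
             \<and> ((\<exists>c. \<forall>z \<in> U. f z = c) \<longleftrightarrow> gt \<in> cscK_metrics U)))
     \<and> (\<forall>q p \<rho> R. em_data U q p \<rho> R \<and> (\<forall>(x, y) \<in> U. em_scal q p R x y > 0)
           \<longrightarrow> (\<exists>!k. k > 0 \<and>
                 (conformal (\<lambda>z. k * killing_potential U q p z) (em_kahler_metric U q p \<rho> R),
                  \<lambda>z. k * killing_potential U q p z) \<in> normalised_em_pairs U))
     \<and> (\<forall>q p \<rho> R. em_data U q p \<rho> R
           \<longrightarrow> ((\<forall>(x, y) \<in> U. killing_potential U q p (x, y) = 1 / extremal_scal p R x y)
                \<longleftrightarrow> (\<forall>(x, y) \<in> U. em_scal q p R x y = 1)))"
proof -
  have gt: "\<And>x y. (x, y) \<in> U \<Longrightarrow> x > y" using assms(3) by auto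
  note U = assms(1,2) gt
  obtain \<Phi> where bij: "bij_betw \<Phi> (normalised_em_pairs U) (positive_extremal_metrics U)"
    and \<Phi>: "\<And>q p \<rho> R. em_data U q p \<rho> R \<Longrightarrow> (\<forall>(x, y) \<in> U. em_scal q p R x y = 1)
      \<Longrightarrow> \<Phi> (em_pair U q p \<rho> R) = extremal_metric U p \<rho> R"
    using ex_correspondence[OF U] by metis
  have props: "(\<forall>(x, y) \<in> U. f (x, y) = 1 / extremal_scal qb P x y)
      \<and> qb = p \<and> qb * \<pi> + P = p * \<rho> + R \<and> qb * \<pi> - P = p * \<rho> - R
      \<and> (\<forall>(x, y) \<in> U. polar q x y = extremal_scal qb P x y * polar qb x y)
      \<and> (homothetic U g gb \<longleftrightarrow> (\<exists>c. \<forall>z \<in> U. f z = c))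
      \<and> (g = gb \<longleftrightarrow> (\<forall>z \<in> U. f z = 1))
      \<and> ((\<exists>c. \<forall>z \<in> U. f z = c) \<longleftrightarrow> gt \<in> cscK_metrics U)"
    if em: "em_data U q p \<rho> R" "\<forall>(x, y) \<in> U. em_scal q p R x y = 1"
      and defs: "f = killing_potential U q p" "g = em_kahler_metric U q p \<rho> R" "gt = conformal f g"
        "gb = extremal_metric U qb \<pi> P"
      and ex: "extremal_data U qb \<pi> P" and "\<Phi> (gt, f) = gb"
    for q p \<rho> R qb \<pi> P f g gt gb
  proof -
    have "extremal_metric U qb \<pi> P = extremal_metric U p \<rho> R"
      using \<Phi>[OF em] \<open>\<Phi> (gt, f) = gb\<close> unfolding defs em_pair_def by simp
    then have eq: "qb = p" "\<pi> = \<rho>" "P = R"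
      using extremal_metric_inject[OF U ex em_imp_extremal_data[OF em(1)]] by auto
    have "\<forall>(x, y) \<in> U. polar q x y = extremal_scal p R x y * polar p x y"
      using em(1) unfolding extremal_scal_normalised_em[OF em assms(2)]
      by (auto simp: em_data_def)
    moreover have "\<forall>(x, y) \<in> U. killing_potential U q p (x, y) = 1 / extremal_scal p R x y"
      using potential_eq_inverse_scal_iff[OF em(1)] em(2) by blast
    ultimately show ?thesis
      using homothetic_iff_const_killing_potential[OF U em(1)]
        em_kahler_eq_extremal_iff[OF U em(1)] cscK_iff_const_killing_potential[OF U em]
      unfolding defs eq by blast
  qed
  show ?thesis
    by (rule conjI, rule exI[of _ \<Phi>], rule conjI[OF bij], intro allI impI, elim conjE,
        rule props, assumption+)
      (intro conjI allI impI ex1_normalising_factor[OF U] potential_eq_inverse_scal_iff;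
        (elim conjE)?; assumption)
qed

end
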